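(* Let $n\ge1$ and let $F\subset\mathbb{R}^n$ be a non-empty bounded set that is uniformly profile-regular, with profile $\rho_F$. Then $$\underline{\mathrm P}(F)=\bigcap_{a\in\mathcal K_n}\{\alpha\in[0,\infty)^n:\alpha\cdot a\le\rho_F(a)\},$$ $$\overline{\mathrm P}(F)=\Bigl\{\alpha\in[0,\infty)^n:\ \inf_{a\in\mathcal C_n}\bigl(\alpha\cdot a-\rho_F(a)\bigr)\le0\Bigr\}.$$
   Context: An open box in $\mathbb{R}^n$ is an open rectangular box with positive side lengths and arbitrary orientation; its side lengths in decreasing order are $l_1(B)\ge\cdots\ge l_n(B)>0$. Let $\Delta_n=\{\delta\in(0,1)^n:\delta_1\ge\cdots\ge\delta_n\}$. For non-empty bounded $F\subset\mathbb{R}^n$ and $\delta\in\Delta_n$, $N(F;\delta)$ is the least number of open boxes $B$ needed to cover $F$, subject to $l_i(B)\le\delta_i$ for $1\le i\le n$ for every box in the cover (boxes may have different orientations). For $\alpha\in[0,\infty)^n$ write $\delta^\alpha=\prod_i\delta_i^{\alpha_i}$. The lower and upper box dimension prints are $$\underline{\mathrm P}(F)=\Bigl\{\alpha\in[0,\infty)^n:\liminf_{\delta\in\Delta_n,\,\delta_1\downarrow0}N(F;\delta)\delta^\alpha>0\Bigr\},\quad \overline{\mathrm P}(F)=\Bigl\{\alpha\in[0,\infty)^n:\limsup_{\delta\in\Delta_n,\,\delta_1\downarrow0}N(F;\delta)\delta^\alpha>0\Bigr\},$$ the limits being over all of $\Delta_n$ as $\delta_1\downarrow0$. Let $\mathcal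 K_n=\{a\in(0,\infty)^n:a_1\le\cdots\le a_n\}$ and $\mathcal C_n=\{a\in\mathcal K_n:a_1=1\}$. For $a\in\mathcal K_n$, $t>0$ let $e^{-ta}=(e^{-ta_1},\dots,e^{-ta_n})$. The profile of $F$ exists if for every $a\in\mathcal K_n$ the limit $\rho_F(a)=\lim_{t\to\infty}\frac1t\log N(F;e^{-ta})$ exists. $F$ is uniformly profile-regular if its profile exists and there are $C\ge1$ and $t_0>0$ such that $$C^{-1}e^{t\rho_F(a)}\le N(F;e^{-ta})\le Ce^{t\rho_F(a)}\qquad(a\in\mathcal C_n,\ t\ge t_0).$$ *)

theory Defs
  imports "HOL-Analysis.Analysis"
begin

text \<open>
  Vectors of length \<open>n \<ge> 1\<close> are elements of \<open>real ^ 'n::{finite,linorder}\<close>, where the index type \<open>'n\<close> is a finite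
  linear order with \<open>n\<close> elements; its least element plays the role of the index \<open>1\<close>.
\<close>

definition first_index :: "'n::{finite,linorder}" where
  "first_index = Min UNIV"

text \<open>
  \<open>open_box_with_sides B l\<close>: \<open>B\<close> is an open rectangular box of arbitrary orientation, and
  \<open>l\<close> is the vector of its side lengths in decreasing order.  Requiring the sides to be sorted
  already in the reference box is no restriction, as coordinate permutations are orthogonal.
\<close>

definition open_box_with_sides :: "(real ^ 'n::{finite,linorder}) set \<Rightarrow> real ^ 'n::{finite,linorder} \<Rightarrow> bool" where
  "open_box_with_sides B l \<longleftrightarrow>
     (\<forall>i. 0 < l $ i) \<and> antimono (\<lambda>i. l $ i) \<and>
     (\<exists>T c. orthogonal_transformation T \<and> B = (\<lambda>y. c + T y) ` box 0 l)"

definition scales :: "(real ^ 'n::{finite,linorder}) set" where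
  "scales = {\<delta>. (\<forall>i. 0 < \<delta> $ i \<and> \<delta> $ i < 1) \<and> antimono (\<lambda>i. \<delta> $ i)}"

text \<open>
  For bounded \<open>F\<close> and \<open>\<delta> \<in> scales\<close> a finite admissible cover exists, so the minimum is attained.
\<close>

definition covering_number :: "(real ^ 'n::{finite,linorder}) set \<Rightarrow> real ^ 'n::{finite,linorder} \<Rightarrow> nat" where
  "covering_number F \<delta> =
     (LEAST m. \<exists>\<B>. finite \<B> \<and> card \<B> = m \<and> F \<subseteq> \<Union>\<B> \<and>
        (\<forall>B\<in>\<B>. \<exists>l. open_box_with_sides B l \<and> (\<forall>i. l $ i \<le> \<delta> $ i)))"

definition multi_powr :: "real ^ 'n::{finite,linorder} \<Rightarrow> real ^ 'n::{finite,linorder} \<Rightarrow> real" where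
  "multi_powr \<delta> \<alpha> = (\<Prod>i\<in>UNIV. (\<delta> $ i) powr (\<alpha> $ i))"

definition nonneg_vectors :: "(real ^ 'n::{finite,linorder}) set" where
  "nonneg_vectors = {\<alpha>. \<forall>i. 0 \<le> \<alpha> $ i}"

text \<open>The filter of \<open>\<delta> \<in> scales\<close> with the largest component \<open>\<delta>\<^sub>1\<close> decreasing to \<open>0\<close>.\<close>

definition scales_to_0 :: "(real ^ 'n::{finite,linorder}) filter" where
  "scales_to_0 = inf (filtercomap (\<lambda>\<delta>. \<delta> $ first_index) (at_right 0)) (principal scales)"

definition lower_print :: "(real ^ 'n::{finite,linorder}) set \<Rightarrow> (real ^ 'n::{finite,linorder}) set" where
  "lower_print F = {\<alpha> \<in> nonneg_vectors.
     Liminf scales_to_0 (\<lambda>\<delta>. ereal (real (covering_number F \<delta>) * multi_powr \<delta> \<alpha>)) > 0}"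

definition upper_print :: "(real ^ 'n::{finite,linorder}) set \<Rightarrow> (real ^ 'n::{finite,linorder}) set" where
  "upper_print F = {\<alpha> \<in> nonneg_vectors.
     Limsup scales_to_0 (\<lambda>\<delta>. ereal (real (covering_number F \<delta>) * multi_powr \<delta> \<alpha>)) > 0}"

definition cone_K :: "(real ^ 'n::{finite,linorder}) set" where
  "cone_K = {a. (\<forall>i. 0 < a $ i) \<and> mono (\<lambda>i. a $ i)}"

definition slice_C :: "(real ^ 'n::{finite,linorder}) set" where
  "slice_C = {a \<in> cone_K. a $ first_index = 1}"

definition exp_scale :: "real \<Rightarrow> real ^ 'n::{finite,linorder} \<Rightarrow> real ^ 'n::{finite,linorder}" where
  "exp_scale t a = (\<chi> i. exp (- t * a $ i))"

definition profile_exists :: "(real ^ 'n::{finite,linorder}) set \<Rightarrow> bool" where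
  "profile_exists F \<longleftrightarrow>
     (\<forall>a\<in>cone_K. \<exists>L::real.
        ((\<lambda>t. 1 / t * ln (real (covering_number F (exp_scale t a)))) \<longlongrightarrow> L) at_top)"

text \<open>Meaningful only on \<^const>\<open>cone_K\<close> and if the profile exists.\<close>

definition profile :: "(real ^ 'n::{finite,linorder}) set \<Rightarrow> real ^ 'n::{finite,linorder} \<Rightarrow> real" where
  "profile F a = Lim at_top (\<lambda>t. 1 / t * ln (real (covering_number F (exp_scale t a))))"

definition uniformly_profile_regular :: "(real ^ 'n::{finite,linorder}) set \<Rightarrow> bool" where
  "uniformly_profile_regular F \<longleftrightarrow>
     profile_exists F \<and>
     (\<exists>C\<ge>1. \<exists>t\<^sub>0>0. \<forall>a\<in>slice_C. \<forall>t\<ge>t\<^sub>0.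
        inverse C * exp (t * profile F a) \<le> real (covering_number F (exp_scale t a)) \<and>
        real (covering_number F (exp_scale t a)) \<le> C * exp (t * profile F a))"

end

theory Submission
  imports Defs
begin

text \<open>
  Logarithmic polar coordinates linearise the problem.  Every scale vector is \<open>exp_scale t a\<close> for
  exactly one \<open>t > 0\<close> and one direction \<open>a\<close> in the slice, namely \<open>t = - ln \<delta>\<^sub>1\<close> and
  \<open>a = - ln \<delta> / t\<close>, so that \<open>\<delta>\<^sub>1 \<down> 0\<close> means \<open>t \<rightarrow> \<infinity>\<close>, uniformly in \<open>a\<close>
  (\<open>eventually_scales_to_0\<close>).  In these coordinates \<open>\<delta>\<^sup>\<alpha> = exp (- t (\<alpha> \<bullet> a))\<close>, and
  uniform profile-regularity says that \<open>N(F; \<delta>) \<delta>\<^sup>\<alpha>\<close> equals \<open>exp (- t g(a))\<close> up to a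
  factor in \<open>[1/C, C]\<close>, where \<open>g(a) = \<alpha> \<bullet> a - \<rho>(a)\<close>.

  Everything is then read off from the signs of \<open>g\<close> on the slice.  The lower limit is positive iff
  \<open>exp (- t g(a))\<close> is bounded below for all large \<open>t\<close>, uniformly in \<open>a\<close>, that is, iff
  \<open>g \<le> 0\<close> everywhere; homogeneity of the profile (\<open>profile_scaleR\<close>) extends this from the
  slice to the cone.  The upper limit vanishes iff \<open>exp (- t g(a)) \<rightarrow> 0\<close> uniformly in \<open>a\<close>,
  that is, iff \<open>g\<close> is bounded below by a positive constant.  The infimum of \<open>g\<close> need not be
  attained (for \<open>n \<ge> 2\<close> the slice is unbounded), which is harmless: if \<open>inf g \<le> 0\<close>,
  one can choose for each \<open>t > 0\<close> a direction with \<open>t g(a) \<le> 1\<close>.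
\<close>

section \<open>Logarithmic polar coordinates on the scales\<close>

lemma slice_C_nonempty: "(slice_C :: (real ^ 'n::{finite,linorder}) set) \<noteq> {}"
proof -
  have "(\<chi> i. 1) \<in> (slice_C :: (real ^ 'n::{finite,linorder}) set)"
    by (simp add: slice_C_def cone_K_def mono_def)
  then show ?thesis by blast
qed

lemma exp_scale_scaleR: "exp_scale t (c *\<^sub>R a) = exp_scale (c * t) a"
  by (simp add: exp_scale_def vec_eq_iff algebra_simps)

lemma exp_scale_in_scales:
  assumes "a \<in> cone_K" "t > 0"
  shows "exp_scale t a \<in> scales"
  using assms by (auto simp: scales_def cone_K_def exp_scale_def antimono_def mono_def)

lemma exp_scale_first_index:
  assumes "a \<in> slice_C"
  shows "exp_scale t a $ first_index = exp (- t)"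
  using assms by (simp add: slice_C_def exp_scale_def)

lemma multi_powr_exp_scale: "multi_powr (exp_scale t a) \<alpha> = exp (- t * (\<alpha> \<bullet> a))"
proof -
  have "multi_powr (exp_scale t a) \<alpha> = (\<Prod>i\<in>UNIV. exp (- t * (\<alpha> $ i * a $ i)))"
    by (simp add: multi_powr_def exp_scale_def powr_def mult_ac)
  also have "\<dots> = exp (\<Sum>i\<in>UNIV. - t * (\<alpha> $ i * a $ i))"
    by (simp only: exp_sum finite)
  also have "\<dots> = exp (- t * (\<alpha> \<bullet> a))"
    by (simp only: inner_vec_def inner_real_def sum_distrib_left)
  finally show ?thesis .
qed

lemma scales_polar_coordinates:
  fixes \<delta> :: "real ^ 'n::{finite,linorder}"
  assumes "\<delta> \<in> scales"
  obtains a where "a \<in> slice_C" "\<delta> = exp_scale (- ln (\<delta> $ first_index)) a"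
proof
  define t where "t = - ln (\<delta> $ first_index)"
  define a where "a = (\<chi> i. - ln (\<delta> $ i) / t)"
  have \<delta>: "0 < \<delta> $ i" "\<delta> $ i < 1" for i
    using assms by (auto simp: scales_def)
  have t: "t > 0"
    using \<delta> by (simp add: t_def)
  have "ln (\<delta> $ j) \<le> ln (\<delta> $ i)" if "i \<le> j" for i j
    using assms that \<delta> by (auto simp: scales_def antimono_def)
  then have "mono (\<lambda>i. a $ i)"
    using t by (simp add: a_def mono_def divide_right_mono)
  moreover have "0 < a $ i" for i
    using \<delta> t by (simp add: a_def divide_neg_pos)
  moreover have "a $ first_index = t / t"
    by (simp add: a_def t_def)
  then have "a $ first_index = 1"
    using t by simp
  ultimately show "a \<in> slice_C"
    by (simp add: slice_C_def cone_K_def)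
  show "\<delta> = exp_scale (- ln (\<delta> $ first_index)) a"
    using \<delta> t by (simp add: vec_eq_iff exp_scale_def a_def flip: t_def)
qed

text \<open>
  The single largest side \<open>\<delta>\<^sub>1 = e\<^sup>-\<^sup>t\<close> determines \<open>t\<close>, so the filter puts no constraint on the
  direction: the bound on \<open>t\<close> is uniform over the slice.
\<close>

lemma eventually_scales_to_0:
  fixes P :: "real ^ 'n::{finite,linorder} \<Rightarrow> bool"
  shows "eventually P scales_to_0 \<longleftrightarrow> (\<exists>s>0. \<forall>t\<ge>s. \<forall>a\<in>slice_C. P (exp_scale t a))"
    (is "?L \<longleftrightarrow> ?R")
proof -
  have "?L \<longleftrightarrow> (\<exists>b>0. \<forall>\<delta>\<in>scales. \<delta> $ first_index < b \<longrightarrow> P \<delta>)" (is "_ \<longleftrightarrow> ?M")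
  proof -
    have "?L \<longleftrightarrow> (\<exists>Q. (\<exists>b>0. \<forall>y>0. y < b \<longrightarrow> Q y) \<and>
        (\<forall>\<delta>::real ^ 'n::{finite,linorder}. Q (\<delta> $ first_index) \<longrightarrow> \<delta> \<in> scales \<longrightarrow> P \<delta>))"
      by (simp add: scales_to_0_def eventually_inf_principal eventually_filtercomap
          eventually_at_right_field)
    also have "\<dots> \<longleftrightarrow> ?M"
    proof
      assume ?M
      then obtain b where "b > 0" "\<forall>\<delta>\<in>scales. \<delta> $ first_index < b \<longrightarrow> P \<delta>" by blast
      then show "\<exists>Q. (\<exists>b>0. \<forall>y>0. y < b \<longrightarrow> Q y) \<and>
          (\<forall>\<delta>::real ^ 'n::{finite,linorder}. Q (\<delta> $ first_index) \<longrightarrow> \<delta> \<in> scales \<longrightarrow> P \<delta>)"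
        by (intro exI[of _ "\<lambda>y. y < b"]) auto
    qed (force simp: scales_def)
    finally show ?thesis .
  qed
  also have "?M \<longleftrightarrow> ?R"
  proof
    assume ?M
    then obtain b where b: "b > 0" "\<And>\<delta>. \<delta> \<in> scales \<Longrightarrow> \<delta> $ first_index < b \<Longrightarrow> P \<delta>" by blast
    have "P (exp_scale t a)" if "t \<ge> max 1 (1 - ln b)" "a \<in> slice_C"
      for t and a :: "real ^ 'n::{finite,linorder}"
    proof (rule b(2))
      show "exp_scale t a \<in> scales"
        using that by (intro exp_scale_in_scales) (auto simp: slice_C_def)
      have "exp (- t) < exp (ln b)"
        using that by (subst exp_less_cancel_iff) auto
      then show "exp_scale t a $ first_index < b"
        using that b(1) by (simp add: exp_scale_first_index)
    qed
    then show ?R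
      by (intro exI[of _ "max 1 (1 - ln b)"]) auto
  next
    assume ?R
    then obtain s where s: "s > 0" "\<And>t a. t \<ge> s \<Longrightarrow> a \<in> slice_C \<Longrightarrow> P (exp_scale t a)" by blast
    have "P \<delta>" if \<delta>: "\<delta> \<in> scales" "\<delta> $ first_index < exp (- s)" for \<delta>
    proof -
      obtain a where a: "a \<in> slice_C" "\<delta> = exp_scale (- ln (\<delta> $ first_index)) a"
        using scales_polar_coordinates[OF \<delta>(1)] .
      have "ln (\<delta> $ first_index) < ln (exp (- s))"
        using \<delta> by (subst ln_less_cancel_iff) (auto simp: scales_def)
      then have "- ln (\<delta> $ first_index) \<ge> s" by simp
      then show ?thesis
        using s(2) a by metis
    qed
    then show ?M
      by (intro exI[of _ "exp (- s)"]) auto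
  qed
  finally show ?thesis .
qed

section \<open>The profile on the cone\<close>

lemma profile_tendsto:
  assumes "profile_exists F" "a \<in> cone_K"
  shows "((\<lambda>t. 1 / t * ln (real (covering_number F (exp_scale t a)))) \<longlongrightarrow> profile F a) at_top"
proof -
  obtain L where L: "((\<lambda>t. 1 / t * ln (real (covering_number F (exp_scale t a)))) \<longlongrightarrow> L) at_top"
    using assms unfolding profile_exists_def by blast
  then have "profile F a = L"
    unfolding profile_def by (rule tendsto_Lim[OF trivial_limit_at_top_linorder])
  with L show ?thesis by simp
qed

lemma scaleR_cone_K: "a \<in> cone_K \<Longrightarrow> c > 0 \<Longrightarrow> c *\<^sub>R a \<in> cone_K"
  by (simp add: cone_K_def mono_def)

text \<open>
  Rescaling the direction by \<open>c\<close> is the time change \<open>t \<mapsto> c t\<close>; the prefactor \<open>1 / t\<close> then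
  produces the factor \<open>c\<close>.
\<close>

lemma profile_scaleR:
  assumes "profile_exists F" "a \<in> cone_K" "c > 0"
  shows "profile F (c *\<^sub>R a) = c * profile F a"
proof -
  let ?h = "\<lambda>t. 1 / t * ln (real (covering_number F (exp_scale t a)))"
  have "filterlim (\<lambda>t. c * t) at_top at_top"
    using assms(3) by (intro filterlim_tendsto_pos_mult_at_top[OF tendsto_const])
      (auto simp: filterlim_ident)
  then have "((\<lambda>t. c * ?h (c * t)) \<longlongrightarrow> c * profile F a) at_top"
    by (intro tendsto_mult tendsto_const filterlim_compose[OF profile_tendsto[OF assms(1,2)]])
  moreover have "c * ?h (c * t) = 1 / t * ln (real (covering_number F (exp_scale t (c *\<^sub>R a))))" for t
    using assms(3) by (simp add: exp_scale_scaleR)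
  ultimately show ?thesis
    using profile_tendsto[OF assms(1) scaleR_cone_K[OF assms(2,3)]]
    by (intro tendsto_unique[OF trivial_limit_at_top_linorder]) auto
qed

lemma cone_K_normalize:
  fixes a :: "real ^ 'n::{finite,linorder}"
  assumes "a \<in> cone_K"
  obtains c b where "c > 0" "b \<in> slice_C" "a = c *\<^sub>R b"
proof
  let ?c = "a $ first_index"
  show c: "?c > 0"
    using assms by (simp add: cone_K_def)
  show "inverse ?c *\<^sub>R a \<in> slice_C"
    using c scaleR_cone_K[OF assms, of "inverse ?c"] by (simp add: slice_C_def)
  show "a = ?c *\<^sub>R (inverse ?c *\<^sub>R a)"
    using c by simp
qed

lemma profile_bound_cone_iff_slice:
  assumes "profile_exists F"
  shows "(\<forall>a\<in>cone_K. \<alpha> \<bullet> a \<le> profile F a) \<longleftrightarrow> (\<forall>a\<in>slice_C. \<alpha> \<bullet> a \<le> profile F a)"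
proof
  assume slice: "\<forall>a\<in>slice_C. \<alpha> \<bullet> a \<le> profile F a"
  show "\<forall>a\<in>cone_K. \<alpha> \<bullet> a \<le> profile F a"
  proof
    fix a :: "real ^ 'a::{finite,linorder}"
    assume "a \<in> cone_K"
    then obtain c b where "c > 0" "b \<in> slice_C" "a = c *\<^sub>R b"
      by (rule cone_K_normalize)
    with slice show "\<alpha> \<bullet> a \<le> profile F a"
      by (simp add: profile_scaleR[OF assms] slice_C_def)
  qed
qed (simp add: slice_C_def)

section \<open>Positivity of the lower and upper limits\<close>

lemma exp_decay_tendsto_0:
  fixes C \<epsilon> :: real
  assumes "\<epsilon> > 0"
  shows "((\<lambda>t. C * exp (- t * \<epsilon>)) \<longlongrightarrow> 0) at_top"
proof -
  have "filterlim (\<lambda>t. \<epsilon> * t) at_top at_top"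
    using assms by (intro filterlim_tendsto_pos_mult_at_top[OF tendsto_const])
      (auto simp: filterlim_ident)
  then have "filterlim (\<lambda>t. - t * \<epsilon>) at_bot at_top"
    using filterlim_compose[OF filterlim_uminus_at_bot_at_top] by (simp add: mult.commute)
  then show ?thesis
    by (intro tendsto_mult_right_zero filterlim_compose[OF exp_at_bot])
qed

text \<open>
  Uniform profile-regularity pins \<open>u \<delta> = N(F; \<delta>) \<delta>\<^sup>\<alpha>\<close> between constant multiples of
  \<open>exp (- t g(a))\<close>.  The criteria below use only this, so they are stated for arbitrary \<open>u\<close>
  and \<open>g\<close>.
\<close>

lemma Liminf_scales_pos_iff:
  fixes u :: "real ^ 'n::{finite,linorder} \<Rightarrow> real"
  assumes "C > 0" "t\<^sub>0 > 0"
    and lower: "\<And>a t. a \<in> slice_C \<Longrightarrow> t \<ge> t\<^sub>0 \<Longrightarrow> inverse C * exp (- t * g a) \<le> u (exp_scale t a)"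
    and upper: "\<And>a t. a \<in> slice_C \<Longrightarrow> t \<ge> t\<^sub>0 \<Longrightarrow> u (exp_scale t a) \<le> C * exp (- t * g a)"
  shows "Liminf scales_to_0 (\<lambda>\<delta>. ereal (u \<delta>)) > 0 \<longleftrightarrow> (\<forall>a\<in>slice_C. g a \<le> 0)"
proof
  assume "Liminf scales_to_0 (\<lambda>\<delta>. ereal (u \<delta>)) > 0"
  then obtain c where "0 < ereal c" "ereal c < Liminf scales_to_0 (\<lambda>\<delta>. ereal (u \<delta>))"
    using ereal_dense2 by blast
  then have c: "0 < c" "eventually (\<lambda>\<delta>. ereal c < ereal (u \<delta>)) scales_to_0"
    by (auto dest: less_LiminfD)
  then obtain s where s: "\<And>t a. t \<ge> s \<Longrightarrow> a \<in> slice_C \<Longrightarrow> c < u (exp_scale t a)"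
    by (auto simp: eventually_scales_to_0)
  show "\<forall>a\<in>slice_C. g a \<le> 0"
  proof (rule ballI, rule ccontr)
    fix a :: "real ^ 'n::{finite,linorder}"
    assume a: "a \<in> slice_C" "\<not> g a \<le> 0"
    then have "g a > 0" by simp
    have "((\<lambda>t. C * exp (- t * g a)) \<longlongrightarrow> 0) at_top"
      using \<open>g a > 0\<close> by (rule exp_decay_tendsto_0)
    then have "eventually (\<lambda>t. C * exp (- t * g a) < c) at_top"
      using c(1) by (rule order_tendstoD)
    then obtain r where r: "\<And>t. t \<ge> r \<Longrightarrow> C * exp (- t * g a) < c"
      by (auto simp: eventually_at_top_linorder)
    define t where "t = max r (max s t\<^sub>0)"
    have "C * exp (- t * g a) < c" "t \<ge> s" "t \<ge> t\<^sub>0"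
      using r[of t] by (simp_all add: t_def)
    then show False
      using s[OF \<open>t \<ge> s\<close> a(1)] upper[OF a(1) \<open>t \<ge> t\<^sub>0\<close>] by linarith
  qed
next
  assume g: "\<forall>a\<in>slice_C. g a \<le> 0"
  have "inverse C \<le> u (exp_scale t a)" if "t \<ge> t\<^sub>0" "a \<in> slice_C" for t a
  proof -
    have "t * g a \<le> 0"
      using g that assms(2) by (intro mult_nonneg_nonpos) auto
    then have "inverse C * 1 \<le> inverse C * exp (- t * g a)"
      using assms(1) by (intro mult_left_mono) auto
    then show ?thesis
      using lower[OF that(2,1)] by simp
  qed
  then have "eventually (\<lambda>\<delta>. ereal (inverse C) \<le> ereal (u \<delta>)) scales_to_0"
    unfolding eventually_scales_to_0 using assms(2) by (intro exI[of _ t\<^sub>0]) auto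
  then have "ereal (inverse C) \<le> Liminf scales_to_0 (\<lambda>\<delta>. ereal (u \<delta>))"
    by (rule Liminf_bounded)
  moreover have "0 < ereal (inverse C)"
    using assms(1) by simp
  ultimately show "0 < Liminf scales_to_0 (\<lambda>\<delta>. ereal (u \<delta>))"
    by (rule less_le_trans[rotated])
qed

lemma Limsup_scales_pos_iff:
  fixes u :: "real ^ 'n::{finite,linorder} \<Rightarrow> real"
  assumes "C > 0" "t\<^sub>0 > 0"
    and lower: "\<And>a t. a \<in> slice_C \<Longrightarrow> t \<ge> t\<^sub>0 \<Longrightarrow> inverse C * exp (- t * g a) \<le> u (exp_scale t a)"
    and upper: "\<And>a t. a \<in> slice_C \<Longrightarrow> t \<ge> t\<^sub>0 \<Longrightarrow> u (exp_scale t a) \<le> C * exp (- t * g a)"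
  shows "Limsup scales_to_0 (\<lambda>\<delta>. ereal (u \<delta>)) > 0 \<longleftrightarrow> (INF a\<in>slice_C. ereal (g a)) \<le> 0"
proof
  assume pos: "Limsup scales_to_0 (\<lambda>\<delta>. ereal (u \<delta>)) > 0"
  show "(INF a\<in>slice_C. ereal (g a)) \<le> 0"
  proof (rule ccontr)
    assume "\<not> (INF a\<in>slice_C. ereal (g a)) \<le> 0"
    then obtain \<epsilon> where \<epsilon>: "0 < ereal \<epsilon>" "ereal \<epsilon> < (INF a\<in>slice_C. ereal (g a))"
      using ereal_dense2 by (metis not_le)
    then have g: "\<epsilon> \<le> g a" if "a \<in> slice_C" for a
      using less_INF_D[OF \<epsilon>(2) that] by simp
    have "\<forall>\<^sub>F \<delta> in scales_to_0. ereal (u \<delta>) < y" if y: "y > 0" for y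
    proof -
      obtain c where c: "0 < ereal c" "ereal c < y"
        using ereal_dense2[OF y] by blast
      have "((\<lambda>t. C * exp (- t * \<epsilon>)) \<longlongrightarrow> 0) at_top"
        using \<epsilon>(1) by (intro exp_decay_tendsto_0) simp
      then have "eventually (\<lambda>t. C * exp (- t * \<epsilon>) < c) at_top"
        using c(1) by (intro order_tendstoD) auto
      then obtain s where s: "\<And>t. t \<ge> s \<Longrightarrow> C * exp (- t * \<epsilon>) < c"
        by (auto simp: eventually_at_top_linorder)
      have "ereal (u (exp_scale t a)) < y" if "t \<ge> max s t\<^sub>0" "a \<in> slice_C" for t a
      proof -
        have "u (exp_scale t a) \<le> C * exp (- t * g a)"
          using upper that by simp
        also have "\<dots> \<le> C * exp (- t * \<epsilon>)"
          using g[OF that(2)] that(1) assms(1,2) by (intro mult_left_mono) auto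
        also have "\<dots> < c"
          using s that by simp
        finally show ?thesis
          using c(2) by (metis less_ereal.simps(1) less_trans)
      qed
      then show ?thesis
        unfolding eventually_scales_to_0
        using assms(2) by (intro exI[of _ "max s t\<^sub>0"]) auto
    qed
    then have "Limsup scales_to_0 (\<lambda>\<delta>. ereal (u \<delta>)) \<le> 0"
      by (simp add: Limsup_le_iff)
    with pos show False by simp
  qed
next
  assume inf: "(INF a\<in>slice_C. ereal (g a)) \<le> 0"
  let ?c = "inverse C * exp (- 1)"
  show "Limsup scales_to_0 (\<lambda>\<delta>. ereal (u \<delta>)) > 0"
  proof (rule ccontr)
    assume "\<not> Limsup scales_to_0 (\<lambda>\<delta>. ereal (u \<delta>)) > 0"
    moreover have "0 < ereal ?c"
      using assms(1) by simp
    ultimately have "\<forall>\<^sub>F \<delta> in scales_to_0. ereal (u \<delta>) < ereal ?c"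
      unfolding not_less Limsup_le_iff by blast
    then obtain s where s: "\<And>t a. t \<ge> s \<Longrightarrow> a \<in> slice_C \<Longrightarrow> u (exp_scale t a) < ?c"
      by (auto simp: eventually_scales_to_0)
    define t where "t = max s t\<^sub>0"
    have t: "t \<ge> s" "t \<ge> t\<^sub>0" "t > 0"
      using assms(2) by (auto simp: t_def)
    have "(INF a\<in>slice_C. ereal (g a)) < ereal (1 / t)"
      using inf t(3) by (intro le_less_trans[OF inf]) simp
    \<comment> \<open>The direction may depend on \<open>t\<close>: at a single large \<open>t\<close>, a near-minimiser of \<open>g\<close>
      loses at most the factor \<open>exp (- 1)\<close>.\<close>
    then obtain a where a: "a \<in> slice_C" "g a < 1 / t"
      by (auto simp: INF_less_iff)
    then have "t * g a \<le> 1"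
      using t(3) by (simp add: field_simps)
    then have "?c \<le> inverse C * exp (- t * g a)"
      using assms(1) by (intro mult_left_mono) auto
    also have "\<dots> \<le> u (exp_scale t a)"
      using lower a(1) t(2) by simp
    finally show False
      using s[OF t(1) a(1)] by simp
  qed
qed

section \<open>The dimension prints\<close>

theorem proposition2p7:
  fixes F :: "(real ^ 'n::{finite,linorder}) set"
  assumes "F \<noteq> {}" and "bounded F" and "uniformly_profile_regular F"
  shows "lower_print F = (\<Inter>a\<in>cone_K. {\<alpha> \<in> nonneg_vectors. \<alpha> \<bullet> a \<le> profile F a}) \<and>
         upper_print F =
           {\<alpha> \<in> nonneg_vectors. (INF a\<in>slice_C. ereal (\<alpha> \<bullet> a - profile F a)) \<le> 0}"
proof -
  have ex: "profile_exists F"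
    using assms(3) by (simp add: uniformly_profile_regular_def)
  obtain C t\<^sub>0 where C: "C \<ge> 1" "t\<^sub>0 > 0"
    and lower: "\<And>a t. a \<in> slice_C \<Longrightarrow> t \<ge> t\<^sub>0 \<Longrightarrow>
      inverse C * exp (t * profile F a) \<le> real (covering_number F (exp_scale t a))"
    and upper: "\<And>a t. a \<in> slice_C \<Longrightarrow> t \<ge> t\<^sub>0 \<Longrightarrow>
      real (covering_number F (exp_scale t a)) \<le> C * exp (t * profile F a)"
    using assms(3) unfolding uniformly_profile_regular_def by blast
  define u where "u \<alpha> \<delta> = real (covering_number F \<delta>) * multi_powr \<delta> \<alpha>" for \<alpha> \<delta>
  define g where "g \<alpha> a = \<alpha> \<bullet> a - profile F a" for \<alpha> a
  have exp_g: "exp (- t * g \<alpha> a) = exp (t * profile F a) * multi_powr (exp_scale t a) \<alpha>" for t \<alpha> a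
    by (simp add: g_def multi_powr_exp_scale algebra_simps flip: exp_add)
  have powr_nonneg: "multi_powr (exp_scale t a) \<alpha> \<ge> 0" for t \<alpha> and a :: "real ^ 'n::{finite,linorder}"
    by (simp add: multi_powr_exp_scale)
  have u_lower: "inverse C * exp (- t * g \<alpha> a) \<le> u \<alpha> (exp_scale t a)"
    if "a \<in> slice_C" "t \<ge> t\<^sub>0" for \<alpha> a t
    using mult_right_mono[OF lower[OF that] powr_nonneg] by (simp only: exp_g u_def mult.assoc)
  have u_upper: "u \<alpha> (exp_scale t a) \<le> C * exp (- t * g \<alpha> a)"
    if "a \<in> slice_C" "t \<ge> t\<^sub>0" for \<alpha> a t
    using mult_right_mono[OF upper[OF that] powr_nonneg] by (simp only: exp_g u_def mult.assoc)
  have C_pos: "C > 0"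
    using C(1) by simp
  have "\<alpha> \<in> lower_print F \<longleftrightarrow> \<alpha> \<in> nonneg_vectors \<and> (\<forall>a\<in>slice_C. \<alpha> \<bullet> a \<le> profile F a)" for \<alpha>
    using Liminf_scales_pos_iff[OF C_pos C(2) u_lower u_upper, of \<alpha>]
    by (simp add: lower_print_def u_def g_def)
  moreover have "\<alpha> \<in> upper_print F \<longleftrightarrow>
      \<alpha> \<in> nonneg_vectors \<and> (INF a\<in>slice_C. ereal (\<alpha> \<bullet> a - profile F a)) \<le> 0" for \<alpha>
    using Limsup_scales_pos_iff[OF C_pos C(2) u_lower u_upper, of \<alpha>]
    by (simp add: upper_print_def u_def g_def)
  \<comment> \<open>An intersection over an empty index set would be everything, not just the nonnegative vectors.\<close>
  moreover have "cone_K \<noteq> ({} :: (real ^ 'n::{finite,linorder}) set)"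
    using slice_C_nonempty by (auto simp: slice_C_def)
  ultimately show ?thesis
    by (auto simp: profile_bound_cone_iff_slice[OF ex, symmetric])
qed

end
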